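(* Let $P,P'\subset\mathbb{R}^n$ be $n$-dimensional convex lattice polytopes with $d$ vertices. Through the algorithm described in the context, all unimodular affine transformations between $P$ and $P'$ (i.e. all affine maps $\mathbf{x}\mapsto U\mathbf{x}+\mathbf{Z}$ with $U\in GL_n(\mathbb{Z})$, $\mathbf{Z}\in\mathbb{Z}^n$ mapping $P$ onto $P'$) can be obtained.
   Context: A convex lattice polytope is the convex hull of a finite subset of $\mathbb{Z}^n$. $\mathcal{V}(P)$ is the vertex set, and $b_P=\frac{1}{|\mathcal{V}(P)|}\sum_{\mathbf{v}\in\mathcal{V}(P)}\mathbf{v}$ is the vertex average. $G(P)$ is the graph whose nodes are the vertices and whose edges are the one-dimensional edges of $P$. Labels: for $\mathbf{v}\in\mathcal{V}(P)$ with adjacent vertices $\mathbf{v}_1,\dots,\mathbf{v}_m$ in $G(P)$, let $A_{\mathbf{v}}=CC^t$ where $C=(\mathbf{v}_1-\mathbf{v},\dots,\mathbf{v}_m-\mathbf{v})\in\mathbb{Z}^{n\times m}$; the label of $\mathbf{v}$ is $\ell(\mathbf{v})=\det(A_{\mathbf{v}})$. The labeled graph $\mathcal{GW}(P)$ is $G(P)$ with vertex labels $\ell(\mathbf{v})$ and with each edge $\{\mathbf{v}_i,\mathbf{v}_j\}$ carrying the label (weight) $\ell(\mathbf{v}_i)+\ell(\mathbf{v}_j)$. A label-preserving isomorphism is a graph isomorphism preserving labels. The algorithm, on input $P,P'$ (given by their vertices): Step 1. Compute $G(P),G(P')$ and the labels, giving $\mathcal{GW}(P)$ and $\mathcal{GW}(P')$.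 Step 2. Compute one minimum spanning tree $T$ of $\mathcal{GW}(P)$ and all minimum spanning trees $T'_1,\dots,T'_t$ of $\mathcal{GW}(P')$. Drop the edge weights, keeping the vertex labels, to obtain vertex-labeled trees $\mathcal{T}$ and $\mathcal{T}'_1,\dots,\mathcal{T}'_t$. Compute the group $\mathrm{Aut}_\ell(\mathcal{T})$ of vertex-label-preserving automorphisms of $\mathcal{T}$. Step 3. With a tree isomorphism test respecting vertex labels, find those $\mathcal{T}'_j$ that are label-preserving isomorphic to $\mathcal{T}$. Step 4. For a label-preserving isomorphism $\varphi$ between $\mathcal{T}$ and some $\mathcal{T}'_j$, regarded as a vertex map $\varphi:\mathcal{V}(P)\to\mathcal{V}(P')$, and for $\chi\in\mathrm{Aut}_\ell(\mathcal{T})$, decide whether $\varphi\circ\chi$ determines a unimodular affine transformation sending $P$ to $P'$, as follows. Select $n$ linearly independent vectors $\mathbf{w}_1,\dots,\mathbf{w}_n\in\mathcal{V}(P)-b_P$; let $\mathbf{w}'_i+b_{P'}\in\mathcal{V}(P')$ be the image of $\mathbf{w}_i+b_P$ under $\varphi\circ\chi$; set $\mathcal{W}=(\mathbf{w}_1,\dots,\mathbf{w}_n)$, $\mathcal{W}'=(\mathbf{w}'_1,\dots,\mathbf{w}'_n)$; check whether $U:=\mathcal{W}'\mathcal{W}^{-1}$ is unimodular and $\{U\mathbf{v}:\mathbf{v}\in\mathcal{V}(P)-b_P\}=\mathcal{V}(P')-b_{P'}$. If so, the transformation obtained is the one with linear part $U$ mapping $b_P$ to $b_{P'}$, i.e.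 $\mathbf{x}\mapsto U(\mathbf{x}-b_P)+b_{P'}$. Step 5. Carry out Step 4 for each such label-preserving isomorphism $\varphi$ and each $\chi\in\mathrm{Aut}_\ell(\mathcal{T})$. *)

theory Defs
  imports "HOL-Analysis.Analysis"
begin

definition integer_lattice :: "(real ^ 'n) set" where
  "integer_lattice = {x. \<forall>i. x $ i \<in> \<int>}"

definition lattice_polytope :: "(real ^ 'n) set \<Rightarrow> bool" where
  "lattice_polytope P \<longleftrightarrow> (\<exists>S. finite S \<and> S \<subseteq> integer_lattice \<and> P = convex hull S)"

definition integer_matrix :: "real ^ 'n ^ 'm \<Rightarrow> bool" where
  "integer_matrix A \<longleftrightarrow> (\<forall>i j. A $ i $ j \<in> \<int>)"

text \<open>Membership in $GL_n(\mathbb{Z})$: units of the ring of integer matrices.\<close>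

definition unimodular :: "real ^ 'n ^ 'n \<Rightarrow> bool" where
  "unimodular U \<longleftrightarrow> integer_matrix U \<and>
     (\<exists>B. integer_matrix B \<and> U ** B = mat 1 \<and> B ** U = mat 1)"

definition unimodular_transformations ::
  "(real ^ 'n) set \<Rightarrow> (real ^ 'n) set \<Rightarrow> (real ^ 'n \<Rightarrow> real ^ 'n) set" where
  "unimodular_transformations P P' =
     {f. f ` P = P' \<and>
         (\<exists>U Z. unimodular U \<and> Z \<in> integer_lattice \<and> f = (\<lambda>x. U *v x + Z))}"

definition vertices :: "(real ^ 'n) set \<Rightarrow> (real ^ 'n) set" where
  "vertices P = {v. v extreme_point_of P}"

definition vertex_average :: "(real ^ 'n) set \<Rightarrow> real ^ 'n" where
  "vertex_average P = (1 / real (card (vertices P))) *\<^sub>R (\<Sum>v\<in>vertices P. v)"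

definition centered_vertices :: "(real ^ 'n) set \<Rightarrow> (real ^ 'n) set" where
  "centered_vertices P = (\<lambda>v. v - vertex_average P) ` vertices P"

text \<open>Undirected edges are represented as two-element sets of nodes.\<close>

definition graph_edges :: "(real ^ 'n) set \<Rightarrow> (real ^ 'n) set set" where
  "graph_edges P = {{u, v} | u v. u \<in> vertices P \<and> v \<in> vertices P \<and> u \<noteq> v \<and>
                                  closed_segment u v edge_of P}"

definition adjacent_vertices :: "(real ^ 'n) set \<Rightarrow> real ^ 'n \<Rightarrow> (real ^ 'n) set" where
  "adjacent_vertices P v = {u. {u, v} \<in> graph_edges P}"

text \<open>The entries of $C C^t$, where the columns of $C$ are the vectors $u - v$ for the
  vertices $u$ adjacent to $v$. The number of columns depends on $v$; the product does
  not depend on their order.\<close>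

definition label_matrix :: "(real ^ 'n) set \<Rightarrow> real ^ 'n \<Rightarrow> real ^ 'n ^ 'n" where
  "label_matrix P v = (\<chi> i j. \<Sum>u\<in>adjacent_vertices P v. (u - v) $ i * (u - v) $ j)"

definition vertex_label :: "(real ^ 'n) set \<Rightarrow> real ^ 'n \<Rightarrow> real" where
  "vertex_label P v = det (label_matrix P v)"

text \<open>For \<open>e = {u, v}\<close> with \<open>u \<noteq> v\<close> this is the sum of the two vertex labels.\<close>

definition edge_label :: "(real ^ 'n) set \<Rightarrow> (real ^ 'n) set \<Rightarrow> real" where
  "edge_label P e = (\<Sum>v\<in>e. vertex_label P v)"

definition graph_connected :: "'a set \<Rightarrow> 'a set set \<Rightarrow> bool" where
  "graph_connected V E \<longleftrightarrow> (\<forall>u\<in>V. \<forall>v\<in>V. (u, v) \<in> {(x, y). {x, y} \<in> E}\<^sup>*)"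

definition graph_cycle :: "'a set set \<Rightarrow> 'a list \<Rightarrow> bool" where
  "graph_cycle E c \<longleftrightarrow> length c \<ge> 3 \<and> distinct c \<and>
     (\<forall>i<length c. {c ! i, c ! (Suc i mod length c)} \<in> E)"

text \<open>A spanning tree of the graph \<open>(V, E)\<close> has node set \<open>V\<close> and is given by its edge set.\<close>

definition spanning_tree :: "'a set \<Rightarrow> 'a set set \<Rightarrow> 'a set set \<Rightarrow> bool" where
  "spanning_tree V E T \<longleftrightarrow> T \<subseteq> E \<and> graph_connected V T \<and> (\<nexists>c. graph_cycle T c)"

definition minimum_spanning_trees :: "(real ^ 'n) set \<Rightarrow> (real ^ 'n) set set set" where
  "minimum_spanning_trees P =
     {T. spanning_tree (vertices P) (graph_edges P) T \<and>
         (\<forall>S. spanning_tree (vertices P) (graph_edges P) S \<longrightarrow>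
              (\<Sum>e\<in>T. edge_label P e) \<le> (\<Sum>e\<in>S. edge_label P e))}"

text \<open>Isomorphisms between the node-labeled graphs \<open>(V, T, l)\<close> and \<open>(V', T', l')\<close>. Only
  the values on \<open>V\<close> matter.\<close>

definition label_isomorphism ::
  "'a set \<Rightarrow> 'a set set \<Rightarrow> ('a \<Rightarrow> real) \<Rightarrow> 'b set \<Rightarrow> 'b set set \<Rightarrow> ('b \<Rightarrow> real) \<Rightarrow>
   ('a \<Rightarrow> 'b) \<Rightarrow> bool" where
  "label_isomorphism V T l V' T' l' \<phi> \<longleftrightarrow>
     bij_betw \<phi> V V' \<and>
     (\<forall>u\<in>V. \<forall>v\<in>V. {u, v} \<in> T \<longleftrightarrow> {\<phi> u, \<phi> v} \<in> T') \<and>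
     (\<forall>v\<in>V. l' (\<phi> v) = l v)"

definition tree_isomorphism ::
  "(real ^ 'n) set \<Rightarrow> (real ^ 'n) set set \<Rightarrow> (real ^ 'n) set \<Rightarrow> (real ^ 'n) set set \<Rightarrow>
   (real ^ 'n \<Rightarrow> real ^ 'n) \<Rightarrow> bool" where
  "tree_isomorphism P T P' T' \<phi> \<longleftrightarrow>
     label_isomorphism (vertices P) T (vertex_label P) (vertices P') T' (vertex_label P') \<phi>"

text \<open>The pairs $(\varphi, \chi)$ tested by the algorithm once a minimum spanning tree \<open>T\<close> of
  the first graph is chosen; $\chi$ is written \<open>\<sigma>\<close>, as \<open>\<chi>\<close> is the vector binder.\<close>

definition candidates ::
  "(real ^ 'n) set \<Rightarrow> (real ^ 'n) set \<Rightarrow> (real ^ 'n) set set \<Rightarrow>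
   ((real ^ 'n \<Rightarrow> real ^ 'n) \<times> (real ^ 'n \<Rightarrow> real ^ 'n)) set" where
  "candidates P P' T =
     {(\<phi>, \<sigma>). (\<exists>T'\<in>minimum_spanning_trees P'. tree_isomorphism P T P' T' \<phi>) \<and>
              tree_isomorphism P T P T \<sigma>}"

text \<open>An admissible choice of $n$ linearly independent vectors, indexed by the type \<open>'n\<close>.\<close>

definition valid_selection :: "(real ^ 'n) set \<Rightarrow> ('n \<Rightarrow> real ^ 'n) \<Rightarrow> bool" where
  "valid_selection P w \<longleftrightarrow>
     range w \<subseteq> centered_vertices P \<and> inj w \<and> independent (range w)"

definition matrix_of_columns :: "('n \<Rightarrow> real ^ 'n) \<Rightarrow> real ^ 'n ^ 'n" where
  "matrix_of_columns w = (\<chi> i j. w j $ i)"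

definition reconstructed_matrix ::
  "(real ^ 'n) set \<Rightarrow> (real ^ 'n) set \<Rightarrow> (real ^ 'n \<Rightarrow> real ^ 'n) \<Rightarrow> ('n \<Rightarrow> real ^ 'n) \<Rightarrow>
   real ^ 'n ^ 'n" where
  "reconstructed_matrix P P' \<psi> w =
     matrix_of_columns (\<lambda>i. \<psi> (w i + vertex_average P) - vertex_average P')
     ** matrix_inv (matrix_of_columns w)"

definition accepted :: "(real ^ 'n) set \<Rightarrow> (real ^ 'n) set \<Rightarrow> real ^ 'n ^ 'n \<Rightarrow> bool" where
  "accepted P P' U \<longleftrightarrow>
     unimodular U \<and> (\<lambda>v. U *v v) ` centered_vertices P = centered_vertices P'"

definition transformation_of ::
  "(real ^ 'n) set \<Rightarrow> (real ^ 'n) set \<Rightarrow> real ^ 'n ^ 'n \<Rightarrow> real ^ 'n \<Rightarrow> real ^ 'n" where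
  "transformation_of P P' U = (\<lambda>x. U *v (x - vertex_average P) + vertex_average P')"

text \<open>The algorithm leaves two choices open: the minimum spanning tree \<open>T\<close>, and the linearly
  independent vectors, which may be selected anew (here by \<open>sel\<close>) for each pair
  of candidates. \<open>algorithm_run P P' R\<close> says that \<open>R\<close> is the set of transformations obtained
  by the algorithm on input \<open>P\<close>, \<open>P'\<close> for some admissible resolution of these choices.\<close>

definition algorithm_run ::
  "(real ^ 'n) set \<Rightarrow> (real ^ 'n) set \<Rightarrow> (real ^ 'n \<Rightarrow> real ^ 'n) set \<Rightarrow> bool" where
  "algorithm_run P P' R \<longleftrightarrow>
     (\<exists>T sel. T \<in> minimum_spanning_trees P \<and>
        (\<forall>(\<phi>, \<sigma>)\<in>candidates P P' T. valid_selection P (sel \<phi> \<sigma>)) \<and>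
        R = {transformation_of P P' U | U \<phi> \<sigma>.
               (\<phi>, \<sigma>) \<in> candidates P P' T \<and>
               U = reconstructed_matrix P P' (\<phi> \<circ> \<sigma>) (sel \<phi> \<sigma>) \<and>
               accepted P P' U})"

end

theory Submission
  imports Defs
begin

text \<open>
  The algorithm is correct because every accepted candidate is certified independently of the
  graph that suggested it. If a unimodular \<open>U\<close> maps the centred vertices of \<open>P\<close> onto those of
  \<open>P'\<close>, then \<open>x \<mapsto> U (x - b\<^sub>P) + b\<^sub>P'\<close> maps the vertices of \<open>P\<close> onto those of \<open>P'\<close>, hence
  \<open>P\<close> onto \<open>P'\<close>. Its translation part is integral although the vertex averages need not be: it is
  the difference of a lattice point \<open>v'\<close> and a lattice point \<open>U v\<close>, where \<open>v\<close> is any vertex and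
  \<open>v'\<close> its image (\<open>accepted_imp_unimodular_transformation\<close>).

  The algorithm is complete because everything that it looks at is invariant. A unimodular affine
  map \<open>f\<close> from \<open>P\<close> onto \<open>P'\<close> carries faces to faces, so it is an isomorphism of the edge graphs.
  It changes the matrix \<open>C C\<^sup>t\<close> at a vertex into \<open>U C C\<^sup>t U\<^sup>t\<close>, whose determinant is the same as
  \<open>det U = \<plusminus>1\<close>. So \<open>f\<close> preserves vertex labels and weights of spanning trees, and it maps the
  chosen minimum spanning tree \<open>T\<close> to a minimum spanning tree of the second graph. Hence \<open>f\<close>
  itself, paired with the trivial automorphism of \<open>T\<close>, is a candidate, whichever \<open>T\<close> was chosen
  (\<open>unimodular_transformation_candidate\<close>). As \<open>f\<close> maps \<open>b\<^sub>P\<close> to \<open>b\<^sub>P'\<close>, the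
  columns satisfy \<open>W' = U W\<close>, and \<open>W' W\<^sup>-\<^sup>1\<close> is the linear part of \<open>f\<close>, whichever linearly
  independent vectors were selected (\<open>unimodular_transformation_recovered\<close>).

  That the algorithm can run at all takes a separate argument. Linearly independent centred
  vertices exist because \<open>P\<close> is full-dimensional, and a minimum spanning tree exists because the
  edge graph of a polytope is connected (\<open>polytope_graph_connected\<close>). The latter goes by
  induction on the dimension: the facets have connected graphs by induction, two facets that meet
  share a vertex, and the relative boundary, which is the union of the facets, is topologically
  connected as soon as the dimension is at least two.
\<close>

section \<open>Spanning trees of abstract graphs\<close>

lemma sym_adjacency: "sym {(x, y). {x, y} \<in> E}"
  by (auto simp: sym_def insert_commute)

text \<open>The first edge of a cycle is not used when one walks around the cycle the other way, from
  its second node.\<close>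

lemma graph_cycle_reaches:
  assumes "graph_cycle E c" and "Suc 0 \<le> i" and "i < length c"
  shows "(c ! 1, c ! i) \<in> {(x, y). {x, y} \<in> E - {{c ! 0, c ! 1}}}\<^sup>*"
  using assms(2,3)
proof (induction i rule: dec_induct)
  case base
  then show ?case by simp
next
  case (step i)
  have edge: "{c ! i, c ! Suc i} \<in> E"
    using assms(1) step.prems unfolding graph_cycle_def
    by (metis Suc_lessD mod_less)
  have "distinct c" and "0 < length c" and "1 < length c"
    using assms(1) by (auto simp: graph_cycle_def)
  then have "c ! Suc i \<notin> {c ! 0, c ! 1}"
    using nth_eq_iff_index_eq[of c "Suc i" 0] nth_eq_iff_index_eq[of c "Suc i" 1] step.hyps(1) step.prems
    by auto
  then have "{c ! i, c ! Suc i} \<noteq> {c ! 0, c ! 1}"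
    by blast
  with edge have "(c ! i, c ! Suc i) \<in> {(x, y). {x, y} \<in> E - {{c ! 0, c ! 1}}}"
    by simp
  with step show ?case
    by (meson Suc_lessD rtrancl.rtrancl_into_rtrancl)
qed

text \<open>The rest of the cycle is a detour that replaces the removed edge in every walk.\<close>

lemma graph_connected_remove_cycle_edge:
  assumes "graph_connected V E" and "graph_cycle E c"
  shows "graph_connected V (E - {{c ! 0, c ! 1}})"
proof -
  let ?r = "{(x, y). {x, y} \<in> E - {{c ! 0, c ! 1}}}"
  let ?n = "length c"
  have n: "?n \<ge> 3" "0 < ?n" "1 < ?n" "?n - 1 < ?n" and dist: "distinct c"
    using assms(2) by (auto simp: graph_cycle_def)
  have sym: "(y, x) \<in> ?r\<^sup>*" if "(x, y) \<in> ?r\<^sup>*" for x y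
    by (rule symD[OF sym_rtrancl[OF sym_adjacency] that])
  have "(c ! 1, c ! (?n - 1)) \<in> ?r\<^sup>*"
    using graph_cycle_reaches[OF assms(2), of "?n - 1"] n by auto
  moreover have "(c ! (?n - 1), c ! 0) \<in> ?r"
  proof -
    have "{c ! (?n - 1), c ! (Suc (?n - 1) mod ?n)} \<in> E"
      using assms(2) n unfolding graph_cycle_def by blast
    moreover have "Suc (?n - 1) = ?n"
      using n by linarith
    then have "Suc (?n - 1) mod ?n = 0"
      by simp
    moreover have "c ! (?n - 1) \<notin> {c ! 0, c ! 1}"
      using n(1) nth_eq_iff_index_eq[OF dist n(4,2)] nth_eq_iff_index_eq[OF dist n(4,3)]
      by auto
    ultimately show ?thesis by auto
  qed
  ultimately have detour: "(c ! 1, c ! 0) \<in> ?r\<^sup>*"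
    by (rule rtrancl.rtrancl_into_rtrancl)
  have step: "(x, y) \<in> ?r\<^sup>*" if "{x, y} \<in> E" for x y
  proof (cases "{x, y} = {c ! 0, c ! 1}")
    case True
    then show ?thesis using detour sym[OF detour] by (auto simp: doubleton_eq_iff)
  next
    case False
    then show ?thesis using that by auto
  qed
  have "{(x, y). {x, y} \<in> E}\<^sup>* \<subseteq> (?r\<^sup>*)\<^sup>*"
    using step by (intro rtrancl_mono) auto
  then show ?thesis
    using assms(1) unfolding graph_connected_def by auto
qed

text \<open>A connected subgraph with as few edges as possible has no cycle, since an edge of a cycle
  could be removed.\<close>

lemma spanning_tree_exists:
  assumes "finite E" and "graph_connected V E"
  obtains T where "spanning_tree V E T"
proof -
  define \<C> where "\<C> = {T. T \<subseteq> E \<and> graph_connected V T}"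
  have "E \<in> \<C>"
    using assms by (simp add: \<C>_def)
  then obtain T where T: "T \<in> \<C>" and min: "\<And>S. S \<in> \<C> \<Longrightarrow> card T \<le> card S"
    using ex_has_least_nat[of "\<lambda>S. S \<in> \<C>" E card] by blast
  have "\<not> graph_cycle T c" for c
  proof
    assume c: "graph_cycle T c"
    have finT: "finite T"
      using T assms(1) by (auto simp: \<C>_def intro: finite_subset)
    have len: "0 < length c" "1 < length c" "Suc 0 mod length c = 1"
      using c by (auto simp: graph_cycle_def)
    have e: "{c ! 0, c ! 1} \<in> T"
      using c len unfolding graph_cycle_def by metis
    have "T - {{c ! 0, c ! 1}} \<in> \<C>"
      using T c graph_connected_remove_cycle_edge unfolding \<C>_def by blast
    then have "card T \<le> card (T - {{c ! 0, c ! 1}})"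
      by (rule min)
    then show False
      using e finT by (metis card_Diff1_less not_le)
  qed
  then have "spanning_tree V E T"
    using T by (auto simp: spanning_tree_def \<C>_def)
  then show ?thesis by (rule that)
qed

lemma inj_image: "inj f \<Longrightarrow> inj (image f)"
  by (simp add: inj_def inj_image_eq_iff)

lemma spanning_tree_image:
  assumes "inj f" and "spanning_tree V E T"
  shows "spanning_tree (f ` V) (image f ` E) (image f ` T)"
proof -
  have mem: "{f x, f y} \<in> image f ` T \<longleftrightarrow> {x, y} \<in> T" for x y
    using inj_image_mem_iff[OF inj_image, of f "{x, y}" T] assms(1) by simp
  have "(f u, f v) \<in> {(x, y). {x, y} \<in> image f ` T}\<^sup>*"
    if "(u, v) \<in> {(x, y). {x, y} \<in> T}\<^sup>*" for u v
    using that
  proof (induction rule: rtrancl_induct)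
    case (step y z)
    then show ?case
      using mem by (auto intro: rtrancl.rtrancl_into_rtrancl)
  qed simp
  then have conn: "graph_connected (f ` V) (image f ` T)"
    using assms(2) by (auto simp: graph_connected_def spanning_tree_def)
  have "\<not> graph_cycle (image f ` T) c" for c
  proof
    assume c: "graph_cycle (image f ` T) c"
    \<comment> \<open>All nodes of the cycle lie on image edges, so the cycle can be pulled back along \<open>f\<close>.\<close>
    have "set c \<subseteq> range f"
    proof
      fix x assume "x \<in> set c"
      then obtain i where "i < length c" "x = c ! i"
        by (metis in_set_conv_nth)
      then have "{x, c ! (Suc i mod length c)} \<in> image f ` T"
        using c by (auto simp: graph_cycle_def)
      then show "x \<in> range f" by auto
    qed
    then obtain b where b: "c = map f b"
      by (metis ex_map_conv subset_iff rangeE)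
    have "{b ! i, b ! (Suc i mod length b)} \<in> T" if "i < length b" for i
    proof -
      have "Suc i mod length b < length b"
        using that by (intro mod_less_divisor) auto
      moreover have "{c ! i, c ! (Suc i mod length c)} \<in> image f ` T"
        using c that by (simp add: graph_cycle_def b)
      ultimately show ?thesis
        using that by (simp add: b mem del: image_insert)
    qed
    then have "graph_cycle T b"
      using c by (auto simp: graph_cycle_def b distinct_map)
    then show False
      using assms(2) by (auto simp: spanning_tree_def)
  qed
  with conn show ?thesis
    using assms(2) by (auto simp: spanning_tree_def)
qed

section \<open>The edge graph of a polytope is connected\<close>

lemma polytope_eq_convex_hull_vertices:
  assumes "polytope P"
  shows "P = convex hull (vertices P)"
  using Krein_Milman_Minkowski[OF polytope_imp_compact[OF assms] polytope_imp_convex[OF assms]]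
  by (simp add: vertices_def)

lemma finite_vertices: "polytope P \<Longrightarrow> finite (vertices P)"
  unfolding vertices_def by (intro finite_polyhedron_extreme_points polytope_imp_polyhedron)

lemma vertices_nonempty: "polytope P \<Longrightarrow> P \<noteq> {} \<Longrightarrow> vertices P \<noteq> {}"
  using polytope_eq_convex_hull_vertices by fastforce

lemma vertices_face: "F face_of P \<Longrightarrow> vertices F = vertices P \<inter> F"
  by (auto simp: vertices_def extreme_point_of_face)

lemma graph_edges_face:
  assumes "F face_of P"
  shows "graph_edges F \<subseteq> graph_edges P"
proof -
  have "e edge_of P" if "e edge_of F" for e
    using that assms face_of_trans by (auto simp: edge_of_def)
  then show ?thesis
    using vertices_face[OF assms] unfolding graph_edges_def by blast
qed

lemma finite_graph_edges: "polytope P \<Longrightarrow> finite (graph_edges P)"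
  by (rule finite_subset[of _ "Pow (vertices P)"])
     (auto simp: graph_edges_def finite_vertices)

text \<open>This is the base of the induction on the dimension. Dimension one has to be treated here, as
  the boundary of a segment is not connected: its two end points are joined by the segment itself,
  which is an edge.\<close>

lemma graph_connected_low_dim:
  assumes "polytope P" and "aff_dim P \<le> 1"
  shows "graph_connected (vertices P) (graph_edges P)"
  unfolding graph_connected_def
proof (intro ballI)
  fix u v assume uv: "u \<in> vertices P" "v \<in> vertices P"
  show "(u, v) \<in> {(x, y). {x, y} \<in> graph_edges P}\<^sup>*"
  proof (cases "u = v")
    case False
    have conv: "convex P"
      by (rule polytope_imp_convex[OF assms(1)])
    have uvP: "u \<in> P" "v \<in> P"
      using uv by (auto simp: vertices_def extreme_point_of_def)
    have "aff_dim {u, v} \<le> aff_dim P"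
      using uvP by (intro aff_dim_subset) auto
    then have dim: "aff_dim P = 1"
      using assms(2) False by (simp add: aff_dim_2)
    have "affine hull {u, v} = affine hull P"
      using uvP dim False by (intro aff_dim_eq_full_gen[THEN iffD1]) auto
    then have col: "collinear P"
      by (metis assms(2) collinear_aff_dim)
    \<comment> \<open>Of three distinct collinear points one lies strictly between the others, so it is not extreme.\<close>
    have "vertices P \<subseteq> {u, v}"
    proof
      fix w assume w: "w \<in> vertices P"
      show "w \<in> {u, v}"
      proof (rule ccontr)
        assume "w \<notin> {u, v}"
        moreover have wP: "w \<in> P"
          using w by (auto simp: vertices_def extreme_point_of_def)
        moreover have "collinear {u, v, w}"
          using col uvP wP by (auto intro: collinear_subset)
        ultimately have "u \<in> open_segment v w \<or> v \<in> open_segment w u \<or> w \<in> open_segment u v"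
          using False by (auto simp: open_segment_def collinear_between_cases between_mem_segment)
        then show False
          using uv w uvP wP unfolding vertices_def extreme_point_of_def by auto
      qed
    qed
    then have "vertices P = {u, v}"
      using uv by auto
    then have "P = closed_segment u v"
      using polytope_eq_convex_hull_vertices[OF assms(1)] by (simp add: segment_convex_hull)
    moreover have "P edge_of P"
      using dim conv by (simp add: edge_of_def face_of_refl)
    ultimately have "{u, v} \<in> graph_edges P"
      using uv False unfolding graph_edges_def by auto
    then show ?thesis by auto
  qed simp
qed

text \<open>Fix a vertex \<open>u\<close>. The facets that have a vertex reachable from \<open>u\<close> and the other
  facets have closed unions that cover the relative boundary. If a facet of the first kind met one
  of the second, they would share a vertex, since their intersection is a face; by induction all
  vertices of both would then be reachable. So the two unions are disjoint, and connectedness of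
  the boundary leaves no facet of the second kind.\<close>

theorem polytope_graph_connected:
  assumes "polytope P"
  shows "graph_connected (vertices P) (graph_edges P)"
  using assms
proof (induction "nat (aff_dim P)" arbitrary: P rule: less_induct)
  case less
  show ?case
  proof (cases "aff_dim P \<le> 1")
    case True
    then show ?thesis using graph_connected_low_dim less.prems by blast
  next
    case False
    have poly: "polyhedron P" and conv: "convex P"
      using less.prems by (auto simp: polytope_imp_polyhedron polytope_imp_convex)
    let ?r = "{(x, y). {x, y} \<in> graph_edges P}"
    let ?B = "rel_frontier P"
    have B: "?B = \<Union>{F. F facet_of P}"
      using rel_frontier_of_polyhedron[OF poly] by simp
    have connB: "connected ?B"
      using False conv less.prems by (intro connected_sphere_gen) (auto simp: polytope_imp_bounded)
    have face: "F face_of P" and ptF: "polytope F" and neF: "F \<noteq> {}" if "F facet_of P" for F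
      using that less.prems face_of_polytope_polytope by (auto simp: facet_of_def)
    have within: "(u, v) \<in> ?r\<^sup>*" if F: "F facet_of P" and "u \<in> vertices F" "v \<in> vertices F" for F u v
    proof -
      have "aff_dim F = aff_dim P - 1"
        using F by (simp add: facet_of_def)
      then have "nat (aff_dim F) < nat (aff_dim P)"
        using False by auto
      then have "graph_connected (vertices F) (graph_edges F)"
        using less.hyps ptF[OF F] by blast
      then have "(u, v) \<in> {(x, y). {x, y} \<in> graph_edges F}\<^sup>*"
        using that by (auto simp: graph_connected_def)
      moreover have "{(x, y). {x, y} \<in> graph_edges F} \<subseteq> ?r"
        using graph_edges_face[OF face[OF F]] by auto
      ultimately show ?thesis
        using rtrancl_mono by blast
    qed
    have infacet: "\<exists>F. F facet_of P \<and> v \<in> vertices F" if v: "v \<in> vertices P" for v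
    proof -
      have "P \<noteq> {v}"
        using False by auto
      then have "v \<in> P - rel_interior P"
        using v extreme_point_not_in_REL_INTERIOR[of v P]
        by (auto simp: vertices_def extreme_point_of_def)
      then obtain F where "F facet_of P" "v \<in> F"
        using rel_boundary_of_polyhedron[OF poly] by auto
      then show ?thesis
        using v vertices_face[OF face] by blast
    qed
    show ?thesis
      unfolding graph_connected_def
    proof (intro ballI)
      fix u v assume u: "u \<in> vertices P" and v: "v \<in> vertices P"
      define \<A> where "\<A> = {F. F facet_of P \<and> (\<exists>w\<in>vertices F. (u, w) \<in> ?r\<^sup>*)}"
      define \<D> where "\<D> = {F. F facet_of P} - \<A>"
      have all: "(u, w) \<in> ?r\<^sup>*" if "F \<in> \<A>" "w \<in> vertices F" for F w
        using that within unfolding \<A>_def by (blast intro: rtrancl_trans)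
      have fin: "finite {F. F facet_of P}"
        by (rule finite_polyhedron_facets[OF poly])
      have "finite \<A>" "finite \<D>"
        using fin by (auto simp: \<A>_def \<D>_def)
      moreover have "closed F" if "F \<in> \<A> \<union> \<D>" for F
        using that ptF polytope_imp_closed by (auto simp: \<A>_def \<D>_def)
      ultimately have clo: "closed (\<Union>\<A>)" "closed (\<Union>\<D>)"
        by (auto intro!: closed_Union)
      have cover: "?B = \<Union>\<A> \<union> \<Union>\<D>"
        unfolding B \<A>_def \<D>_def by blast
      have "\<Union>\<A> \<inter> \<Union>\<D> = {}"
      proof (rule ccontr)
        assume "\<Union>\<A> \<inter> \<Union>\<D> \<noteq> {}"
        then obtain F G where FG: "F \<in> \<A>" "G \<in> \<D>" "F \<inter> G \<noteq> {}"
          by blast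
        then have facets: "F facet_of P" "G facet_of P"
          by (auto simp: \<A>_def \<D>_def)
        have I: "F \<inter> G face_of P"
          using facets face by (intro face_of_Int) auto
        then have "polytope (F \<inter> G)"
          using less.prems face_of_polytope_polytope by blast
        then obtain w where "w \<in> vertices (F \<inter> G)"
          using FG(3) vertices_nonempty by blast
        then have w: "w \<in> vertices F" "w \<in> vertices G"
          using vertices_face[OF I] vertices_face[OF face[OF facets(1)]]
            vertices_face[OF face[OF facets(2)]] by auto
        then have "G \<in> \<A>"
          using all[OF FG(1)] facets(2) by (auto simp: \<A>_def)
        then show False
          using FG(2) by (simp add: \<D>_def)
      qed
      moreover have "\<Union>\<A> \<noteq> {}"
        using infacet[OF u] unfolding \<A>_def vertices_def extreme_point_of_def by blast
      moreover have "\<Union>\<A> \<inter> ?B = \<Union>\<A>" "\<Union>\<D> \<inter> ?B = \<Union>\<D>"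
        unfolding cover by auto
      ultimately have "\<Union>\<D> = {}"
        using connected_closedD[OF connB, of "\<Union>\<A>" "\<Union>\<D>"] clo cover by auto
      then have "\<D> = {}"
        using neF by (auto simp: \<D>_def)
      then show "(u, v) \<in> ?r\<^sup>*"
        using infacet[OF v] all by (auto simp: \<D>_def)
    qed
  qed
qed

theorem minimum_spanning_tree_exists:
  assumes "polytope P"
  obtains T where "T \<in> minimum_spanning_trees P"
proof -
  define \<S> where "\<S> = {T. spanning_tree (vertices P) (graph_edges P) T}"
  define wt where "wt T = (\<Sum>e\<in>T. edge_label P e)" for T
  have "finite \<S>"
    by (rule finite_subset[of _ "Pow (graph_edges P)"])
       (auto simp: \<S>_def spanning_tree_def finite_graph_edges assms)
  moreover have "\<S> \<noteq> {}"
    using spanning_tree_exists[OF finite_graph_edges[OF assms] polytope_graph_connected[OF assms]]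
    by (auto simp: \<S>_def)
  ultimately have "\<exists>T\<in>\<S>. \<forall>S\<in>\<S>. wt T \<le> wt S"
    by (metis arg_min_if_finite(1) arg_min_least)
  then show ?thesis
    using that by (auto simp: minimum_spanning_trees_def \<S>_def wt_def)
qed

section \<open>Selecting linearly independent vectors\<close>

text \<open>The translate by the vertex average of the span is an affine space that contains all
  vertices, hence the polytope, so it is full-dimensional.\<close>

lemma span_centered_vertices:
  fixes P :: "(real ^ 'n) set"
  assumes "polytope P" and "aff_dim P = int CARD('n)"
  shows "span (centered_vertices P) = UNIV"
proof -
  let ?b = "vertex_average P"
  let ?A = "(\<lambda>x. ?b + x) ` span (centered_vertices P)"
  have aff: "affine ?A"
    by (simp add: affine_translation[symmetric] subspace_imp_affine)
  have "v \<in> ?A" if "v \<in> vertices P" for v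
    using that by (intro image_eqI[of _ _ "v - ?b"]) (auto simp: centered_vertices_def intro: span_base)
  then have "P \<subseteq> ?A"
    using polytope_eq_convex_hull_vertices[OF assms(1)]
    by (metis aff affine_imp_convex hull_minimal subsetI)
  then have "aff_dim P \<le> aff_dim ?A"
    by (rule aff_dim_subset)
  then have "int CARD('n) \<le> int (dim (span (centered_vertices P)))"
    by (simp add: aff_dim_translation_eq assms(2) aff_dim_subspace)
  then have "dim (centered_vertices P) = DIM(real ^ 'n)"
    using dim_subset_UNIV[of "centered_vertices P"] by simp
  then show ?thesis
    by (rule dim_eq_full[THEN iffD1])
qed

lemma valid_selection_exists:
  fixes P :: "(real ^ 'n) set"
  assumes "polytope P" and "aff_dim P = int CARD('n)"
  obtains w where "valid_selection P w"
proof -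
  obtain B where B: "B \<subseteq> centered_vertices P" "independent B" "centered_vertices P \<subseteq> span B"
      "card B = dim (centered_vertices P)"
    using basis_exists by blast
  have "dim (centered_vertices P) = CARD('n)"
    using span_centered_vertices[OF assms] by (metis dim_eq_full DIM_cart DIM_real mult.right_neutral)
  then have "card (UNIV :: 'n set) = card B" "finite B"
    using B independent_imp_finite by auto
  then obtain w where "bij_betw w (UNIV :: 'n set) B"
    using finite_same_card_bij[of "UNIV :: 'n set" B] by auto
  then have "valid_selection P w"
    using B by (auto simp: valid_selection_def bij_betw_def)
  then show ?thesis by (rule that)
qed

lemma matrix_mult_matrix_inv: "invertible A \<Longrightarrow> A ** matrix_inv A = mat 1"
  unfolding invertible_def matrix_inv_def by (rule someI2_ex) auto

lemma invertible_matrix_of_selection: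
  fixes w :: "'n \<Rightarrow> real ^ 'n"
  assumes "valid_selection P w"
  shows "invertible (matrix_of_columns w)"
proof -
  have "card (range w) = CARD('n)"
    using assms by (simp add: valid_selection_def card_image)
  then have "span (range w) = UNIV"
    using assms by (metis DIM_cart DIM_real dim_eq_card_independent dim_eq_full mult.right_neutral valid_selection_def)
  moreover have "columns (matrix_of_columns w) = range w"
    by (auto simp: columns_def column_def matrix_of_columns_def vec_lambda_eta)
  ultimately show ?thesis
    using matrix_right_invertible_span_columns[of "matrix_of_columns w"]
    by (auto simp: span_vec_eq invertible_right_inverse)
qed

section \<open>Unimodular matrices and integrality\<close>

text \<open>The determinants of an integer matrix and its integer inverse are integers with product one.\<close>

lemma unimodular_det_square:
  assumes "unimodular U"
  shows "(det U)\<^sup>2 = 1"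
proof -
  obtain B where B: "integer_matrix B" "U ** B = mat 1"
    using assms by (auto simp: unimodular_def)
  have int: "det A \<in> \<int>" if "integer_matrix A" for A :: "real ^ 'n ^ 'n"
    using that by (auto simp: det_def integer_matrix_def intro!: Ints_sum Ints_mult Ints_prod)
  obtain a b :: int where ab: "det U = of_int a" "det B = of_int b"
    using int[OF B(1)] int[of U] assms by (auto simp: unimodular_def elim!: Ints_cases)
  have "det U * det B = 1"
    using B(2) by (metis det_I det_mul)
  then have "a * b = 1"
    unfolding ab by (metis of_int_eq_1_iff of_int_mult)
  then have "a = 1 \<or> a = -1"
    using zmult_eq_1_iff by blast
  then show ?thesis
    using ab by auto
qed

lemma integer_lattice_diff: "x \<in> integer_lattice \<Longrightarrow> y \<in> integer_lattice \<Longrightarrow> x - y \<in> integer_lattice"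
  by (auto simp: integer_lattice_def)

lemma integer_lattice_matrix_mult:
  "integer_matrix A \<Longrightarrow> x \<in> integer_lattice \<Longrightarrow> A *v x \<in> integer_lattice"
  by (auto simp: integer_lattice_def integer_matrix_def matrix_vector_mult_def)

lemma unimodular_inverse:
  assumes "unimodular U"
  obtains B where "unimodular B" "U ** B = mat 1" "B ** U = mat 1"
  using assms by (auto simp: unimodular_def)

lemma unimodular_inj: "unimodular U \<Longrightarrow> inj ((*v) U)"
  by (metis unimodular_inverse injI matrix_vector_mul_assoc matrix_vector_mul_lid)

lemma lattice_polytope_vertices:
  assumes "lattice_polytope P"
  shows "polytope P" and "vertices P \<subseteq> integer_lattice"
proof -
  obtain S where S: "finite S" "S \<subseteq> integer_lattice" "P = convex hull S"
    using assms by (auto simp: lattice_polytope_def)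
  then show "polytope P"
    by (auto simp: polytope_def)
  show "vertices P \<subseteq> integer_lattice"
    using S extreme_points_of_convex_hull[of S] by (auto simp: vertices_def)
qed

section \<open>Invariance under unimodular transformations\<close>

text \<open>Since the inverse is of the same kind, it suffices below to show that structure is
  transported in one direction.\<close>

lemma unimodular_transformations_inverse:
  assumes "f \<in> unimodular_transformations P P'"
  shows "inv f \<in> unimodular_transformations P' P" and "inv f (f x) = x" and "f (inv f x) = x"
proof -
  obtain U Z where f: "f ` P = P'" "unimodular U" "Z \<in> integer_lattice" "f = (\<lambda>x. U *v x + Z)"
    using assms by (auto simp: unimodular_transformations_def)
  obtain B where B: "unimodular B" "U ** B = mat 1" "B ** U = mat 1"
    using unimodular_inverse[OF f(2)] by blast
  define g where "g = (\<lambda>x. B *v x + - (B *v Z))"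
  have gf: "g (f x) = x" for x
    unfolding g_def f(4) by (simp add: matrix_vector_right_distrib matrix_vector_mul_assoc B)
  have fg: "f (g x) = x" for x
    unfolding g_def f(4)
    by (simp add: matrix_vector_right_distrib matrix_vector_mul_assoc B
        matrix_vector_mult_diff_distrib)
  have "- (B *v Z) \<in> integer_lattice"
    using integer_lattice_matrix_mult[of B Z] B(1) f(3)
    by (auto simp: unimodular_def integer_lattice_def)
  moreover have "g ` P' = P"
    using f(1) gf by (auto simp: image_image)
  ultimately have "g \<in> unimodular_transformations P' P"
    using B(1) unfolding unimodular_transformations_def g_def by blast
  moreover have "inv f = g"
    using gf fg by (intro inv_equality)
  ultimately show "inv f \<in> unimodular_transformations P' P" "inv f (f x) = x" "f (inv f x) = x"
    using gf fg by simp_all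
qed

lemma unimodular_transformations_inj:
  "f \<in> unimodular_transformations P P' \<Longrightarrow> inj f"
  by (metis unimodular_transformations_inverse(2) injI)

lemma unimodular_transformation_face:
  assumes "f \<in> unimodular_transformations P P'"
  shows "f ` F face_of P' \<longleftrightarrow> F face_of P" and "aff_dim (f ` F) = aff_dim F"
proof -
  obtain U Z where f: "f ` P = P'" "unimodular U" "f = (\<lambda>x. U *v x + Z)"
    using assms by (auto simp: unimodular_transformations_def)
  have img: "f ` S = (+) Z ` ((*v) U) ` S" for S
    by (auto simp: f(3) image_image add.commute)
  have lin: "linear ((*v) U)" "inj ((*v) U)"
    using unimodular_inj[OF f(2)] by auto
  show "f ` F face_of P' \<longleftrightarrow> F face_of P"
    unfolding f(1)[symmetric] img by (simp only: face_of_translation_eq face_of_linear_image[OF lin])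
  show "aff_dim (f ` F) = aff_dim F"
    unfolding img by (simp only: aff_dim_translation_eq aff_dim_injective_linear_image[OF lin])
qed

lemma unimodular_transformation_vertices:
  assumes "f \<in> unimodular_transformations P P'"
  shows "vertices P' = f ` vertices P"
proof -
  have iff: "f x \<in> vertices P' \<longleftrightarrow> x \<in> vertices P" for x
    using unimodular_transformation_face(1)[OF assms, of "{x}"]
    by (simp only: vertices_def mem_Collect_eq image_insert image_empty face_of_singleton)
  have "f ` P = P'"
    using assms by (simp add: unimodular_transformations_def)
  then have "vertices P' \<subseteq> range f"
    by (auto simp: vertices_def extreme_point_of_def)
  with iff show ?thesis by blast
qed

lemma unimodular_transformation_edges:
  assumes "f \<in> unimodular_transformations P P'"
  shows "{f u, f v} \<in> graph_edges P' \<longleftrightarrow> {u, v} \<in> graph_edges P"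
proof -
  have *: "{f u, f v} \<in> graph_edges P'"
    if f: "f \<in> unimodular_transformations P P'" and uv: "{u, v} \<in> graph_edges P"
    for f :: "real ^ 'n \<Rightarrow> real ^ 'n" and P P' u v
  proof -
    obtain U Z where fUZ: "f = (\<lambda>x. U *v x + Z)"
      using f by (auto simp: unimodular_transformations_def)
    have seg: "closed_segment (f x) (f y) = f ` closed_segment x y" for x y
    proof -
      have "closed_segment (f x) (f y) = (+) Z ` closed_segment (U *v x) (U *v y)"
        unfolding fUZ by (metis add.commute closed_segment_translation)
      also have "\<dots> = f ` closed_segment x y"
        using closed_segment_linear_image[of "(*v) U" x y]
        by (simp add: fUZ image_image add.commute)
      finally show ?thesis .
    qed
    obtain x y where xy: "{u, v} = {x, y}" "x \<in> vertices P" "y \<in> vertices P" "x \<noteq> y"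
        "closed_segment x y edge_of P"
      using uv unfolding graph_edges_def by blast
    have "closed_segment (f x) (f y) edge_of P'"
      using xy(5) unimodular_transformation_face[OF f] by (simp add: seg edge_of_def)
    moreover have "f x \<in> vertices P'" "f y \<in> vertices P'" "f x \<noteq> f y"
      using xy unimodular_transformation_vertices[OF f] unimodular_transformations_inj[OF f]
      by (auto dest: injD)
    moreover have "{f u, f v} = {f x, f y}"
      using xy(1) by (metis image_empty image_insert)
    ultimately show ?thesis
      unfolding graph_edges_def by blast
  qed
  define g where "g = inv f"
  have g: "g \<in> unimodular_transformations P' P" and gf: "g (f x) = x" for x
    by (simp_all add: g_def unimodular_transformations_inverse[OF assms])
  show ?thesis
    using *[OF assms, of u v] *[OF g, of "f u" "f v"] unfolding gf by (rule iffI[rotated])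
qed

lemma unimodular_transformation_graph_edges:
  assumes "f \<in> unimodular_transformations P P'"
  shows "graph_edges P' = image f ` graph_edges P"
proof
  define g where "g = inv f"
  have fg: "f (g x) = x" for x
    by (simp add: g_def unimodular_transformations_inverse[OF assms])
  show "graph_edges P' \<subseteq> image f ` graph_edges P"
  proof
    fix e assume e: "e \<in> graph_edges P'"
    then obtain u v where "e = {u, v}"
      by (auto simp: graph_edges_def)
    then have e': "e = f ` {g u, g v}" "e = {f (g u), f (g v)}"
      by (simp_all add: fg)
    then have "{g u, g v} \<in> graph_edges P"
      using e unimodular_transformation_edges[OF assms] by metis
    then show "e \<in> image f ` graph_edges P"
      using e'(1) by blast
  qed
  show "image f ` graph_edges P \<subseteq> graph_edges P'"
  proof
    fix e assume "e \<in> image f ` graph_edges P"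
    then obtain d where d: "d \<in> graph_edges P" "e = f ` d"
      by blast
    then obtain u v where "d = {u, v}"
      by (auto simp: graph_edges_def)
    then show "e \<in> graph_edges P'"
      using d unimodular_transformation_edges[OF assms, of u v] by simp
  qed
qed

text \<open>With \<open>f v = U v + Z\<close>, the columns \<open>u - v\<close> of \<open>C\<close> become the columns
  \<open>U (u - v)\<close> of \<open>U C\<close>. So the label matrix \<open>C C\<^sup>t\<close> becomes \<open>U C C\<^sup>t U\<^sup>t\<close>, and the label is
  multiplied by the square of \<open>det U\<close>, which is one.\<close>

lemma unimodular_transformation_label:
  assumes "f \<in> unimodular_transformations P P'"
  shows "vertex_label P' (f v) = vertex_label P v"
proof -
  obtain U Z where f: "unimodular U" "f = (\<lambda>x. U *v x + Z)"
    using assms by (auto simp: unimodular_transformations_def)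
  define g where "g = inv f"
  have fg: "f (g x) = x" for x
    by (simp add: g_def unimodular_transformations_inverse[OF assms])
  have adj: "adjacent_vertices P' (f v) = f ` adjacent_vertices P v"
  proof -
    have "u \<in> f ` adjacent_vertices P v" if "{u, f v} \<in> graph_edges P'" for u
      using that fg[of u] unimodular_transformation_edges[OF assms, of "g u" v]
      by (metis adjacent_vertices_def image_eqI mem_Collect_eq)
    then show ?thesis
      using unimodular_transformation_edges[OF assms] by (auto simp: adjacent_vertices_def)
  qed
  have diff: "f u - f v = U *v (u - v)" for u
    by (simp add: f(2) matrix_vector_mult_diff_distrib)
  have inj: "inj_on f (adjacent_vertices P v)"
    using unimodular_transformations_inj[OF assms] by (rule inj_on_subset) simp
  have "label_matrix P' (f v) = U ** label_matrix P v ** transpose U"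
  proof -
    have "label_matrix P' (f v) $ i $ j = (U ** label_matrix P v ** transpose U) $ i $ j" for i j
    proof -
      let ?N = "adjacent_vertices P v"
      have "label_matrix P' (f v) $ i $ j = (\<Sum>u\<in>?N. (U *v (u - v)) $ i * (U *v (u - v)) $ j)"
        by (simp add: label_matrix_def adj sum.reindex[OF inj] diff
            del: vector_minus_component)
      also have "\<dots> = (\<Sum>u\<in>?N. \<Sum>l\<in>UNIV. \<Sum>k\<in>UNIV. U $ i $ k * ((u - v) $ k * (u - v) $ l) * U $ j $ l)"
        by (simp add: matrix_vector_mult_def sum_product mult_ac del: vector_minus_component)
           (subst sum.swap, simp add: mult_ac)
      also have "\<dots> = (\<Sum>l\<in>UNIV. \<Sum>k\<in>UNIV. \<Sum>u\<in>?N. U $ i $ k * ((u - v) $ k * (u - v) $ l) * U $ j $ l)"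
        by (subst sum.swap, intro sum.cong refl sum.swap)
      also have "\<dots> = (U ** label_matrix P v ** transpose U) $ i $ j"
        by (simp add: label_matrix_def matrix_matrix_mult_def transpose_def
            sum_distrib_left sum_distrib_right del: vector_minus_component)
      finally show ?thesis .
    qed
    then show ?thesis by (simp add: vec_eq_iff)
  qed
  then have "vertex_label P' (f v) = (det U)\<^sup>2 * vertex_label P v"
    by (simp add: vertex_label_def det_mul power2_eq_square)
  then show ?thesis
    by (simp add: unimodular_det_square[OF f(1)])
qed

lemma unimodular_transformation_weight:
  assumes "f \<in> unimodular_transformations P P'"
  shows "(\<Sum>e\<in>image f ` T. edge_label P' e) = (\<Sum>e\<in>T. edge_label P e)"
proof -
  have inj: "inj f"
    by (rule unimodular_transformations_inj[OF assms])
  have "edge_label P' (f ` e) = edge_label P e" for e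
    unfolding edge_label_def
    by (subst sum.reindex[OF inj_on_subset[OF inj]])
       (simp_all add: unimodular_transformation_label[OF assms])
  moreover have "inj_on (image f) T"
    using inj_image[OF inj] by (rule inj_on_subset) simp
  ultimately show ?thesis
    by (simp add: sum.reindex)
qed

text \<open>Minimality is transported by pulling back every competing spanning tree along the inverse
  map, which preserves weights as well.\<close>

lemma unimodular_transformation_minimum_spanning_tree:
  assumes f: "f \<in> unimodular_transformations P P'" and T: "T \<in> minimum_spanning_trees P"
  shows "image f ` T \<in> minimum_spanning_trees P'"
proof -
  define g where "g = inv f"
  have g: "g \<in> unimodular_transformations P' P"
    by (simp add: g_def unimodular_transformations_inverse[OF f])
  have tree: "spanning_tree (vertices P') (graph_edges P') (image h ` S)"
    if "h \<in> unimodular_transformations P P'" "spanning_tree (vertices P) (graph_edges P) S"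
    for h :: "real ^ 'n \<Rightarrow> real ^ 'n" and P P' S
    using spanning_tree_image[OF unimodular_transformations_inj[OF that(1)] that(2)]
    by (simp add: unimodular_transformation_vertices[OF that(1)]
        unimodular_transformation_graph_edges[OF that(1)])
  have "(\<Sum>e\<in>image f ` T. edge_label P' e) \<le> (\<Sum>e\<in>S. edge_label P' e)"
    if "spanning_tree (vertices P') (graph_edges P') S" for S
    using T tree[OF g that]
    by (simp add: minimum_spanning_trees_def unimodular_transformation_weight[OF f]
        flip: unimodular_transformation_weight[OF g, of S])
  then show ?thesis
    using T tree[OF f] by (auto simp: minimum_spanning_trees_def)
qed

lemma unimodular_transformation_vertex_average:
  assumes f: "f \<in> unimodular_transformations P P'" and P: "polytope P" "P \<noteq> {}"
  shows "vertex_average P' = f (vertex_average P)"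
proof -
  obtain U Z where U: "f = (\<lambda>x. U *v x + Z)"
    using f by (auto simp: unimodular_transformations_def)
  have inj: "inj_on f (vertices P)"
    using unimodular_transformations_inj[OF f] by (rule inj_on_subset) simp
  have card: "card (vertices P) \<noteq> 0"
    using P by (simp add: finite_vertices vertices_nonempty)
  have "(\<Sum>v\<in>vertices P'. v) = (\<Sum>v\<in>vertices P. U *v v + Z)"
    by (simp add: unimodular_transformation_vertices[OF f] sum.reindex[OF inj]) (simp add: U)
  also have "\<dots> = U *v (\<Sum>v\<in>vertices P. v) + real (card (vertices P)) *\<^sub>R Z"
    by (simp add: sum.distrib sum_constant_scaleR linear_sum[OF matrix_vector_mul_linear] del: sum_constant)
  finally have sum: "(\<Sum>v\<in>vertices P'. v) = U *v (\<Sum>v\<in>vertices P. v) + real (card (vertices P)) *\<^sub>R Z" .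
  have "card (vertices P') = card (vertices P)"
    by (simp add: unimodular_transformation_vertices[OF f] card_image[OF inj])
  then show ?thesis
    using card unfolding vertex_average_def sum
    by (simp add: U scaleR_add_right matrix_vector_mult_scaleR)
qed

section \<open>Correctness and completeness of the search\<close>

text \<open>The vertex averages are only rational in general. That their contribution to the
  translation part is integral is seen at any single vertex, which is a lattice point whose image
  is a lattice point.\<close>

lemma accepted_imp_unimodular_transformation:
  assumes P: "lattice_polytope P" "P \<noteq> {}" and P': "lattice_polytope P'" and acc: "accepted P P' U"
  shows "transformation_of P P' U \<in> unimodular_transformations P P'"
proof -
  let ?f = "transformation_of P P' U"
  let ?b = "vertex_average P" and ?b' = "vertex_average P'"
  define Z where "Z = ?b' - U *v ?b"
  have U: "unimodular U" and img: "(\<lambda>v. U *v v) ` centered_vertices P = centered_vertices P'"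
    using acc by (auto simp: accepted_def)
  have f: "?f = (\<lambda>x. U *v x + Z)"
    by (auto simp: transformation_of_def Z_def matrix_vector_mult_diff_distrib)
  have "?f ` vertices P = (\<lambda>y. y + ?b') ` (\<lambda>v. U *v v) ` centered_vertices P"
    by (simp add: transformation_of_def centered_vertices_def image_image)
  also have "\<dots> = vertices P'"
    unfolding img by (simp add: centered_vertices_def image_image)
  finally have vert: "?f ` vertices P = vertices P'" .
  obtain v where v: "v \<in> vertices P"
    using vertices_nonempty P lattice_polytope_vertices(1) by blast
  have "Z = ?f v - U *v v"
    by (simp add: f)
  moreover have "?f v \<in> integer_lattice" "v \<in> integer_lattice"
    using v vert lattice_polytope_vertices(2)[OF P'] lattice_polytope_vertices(2)[OF P(1)] by auto
  ultimately have Z: "Z \<in> integer_lattice"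
    using U by (auto simp: unimodular_def intro: integer_lattice_diff integer_lattice_matrix_mult)
  have fimg: "?f ` S = (+) Z ` ((*v) U) ` S" for S
    by (auto simp: f image_image add.commute)
  have "?f ` P = convex hull (?f ` vertices P)"
    using polytope_eq_convex_hull_vertices[OF lattice_polytope_vertices(1)[OF P(1)]]
    by (metis fimg convex_hull_linear_image convex_hull_translation matrix_vector_mul_linear)
  also have "\<dots> = P'"
    using polytope_eq_convex_hull_vertices[OF lattice_polytope_vertices(1)[OF P']] vert by simp
  finally show ?thesis
    using U Z f by (auto simp: unimodular_transformations_def)
qed

text \<open>The image of \<open>T\<close> is one of the minimum spanning trees enumerated for the second polytope,
  so the identity suffices as automorphism of \<open>T\<close>.\<close>

lemma unimodular_transformation_candidate:
  assumes f: "f \<in> unimodular_transformations P P'" and T: "T \<in> minimum_spanning_trees P"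
  shows "(f, id) \<in> candidates P P' T"
proof -
  have inj: "inj f"
    by (rule unimodular_transformations_inj[OF f])
  have "{f u, f v} \<in> image f ` T \<longleftrightarrow> {u, v} \<in> T" for u v
    using inj_image_mem_iff[OF inj_image[OF inj], of "{u, v}" T] by simp
  moreover have "bij_betw f (vertices P) (vertices P')"
    using unimodular_transformation_vertices[OF f] inj by (auto simp: bij_betw_def intro: inj_on_subset)
  ultimately have "tree_isomorphism P T P' (image f ` T) f"
    by (simp add: tree_isomorphism_def label_isomorphism_def unimodular_transformation_label[OF f])
  moreover have "tree_isomorphism P T P T id"
    by (simp add: tree_isomorphism_def label_isomorphism_def)
  ultimately show ?thesis
    using unimodular_transformation_minimum_spanning_tree[OF f T] by (auto simp: candidates_def)
qed

text \<open>Because \<open>f\<close> respects vertex averages, it acts on centred vertices by its linear part alone,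
  so any basis of centred vertices determines that part, and the vertex average determines the
  rest.\<close>

lemma unimodular_transformation_recovered:
  assumes f: "f \<in> unimodular_transformations P P'" and P: "polytope P" "P \<noteq> {}"
    and w: "valid_selection P w"
  shows "accepted P P' (reconstructed_matrix P P' f w)"
    and "transformation_of P P' (reconstructed_matrix P P' f w) = f"
proof -
  obtain U Z where U: "unimodular U" "f = (\<lambda>x. U *v x + Z)"
    using f by (auto simp: unimodular_transformations_def)
  have lin: "f x - vertex_average P' = U *v (x - vertex_average P)" for x
    unfolding unimodular_transformation_vertex_average[OF f P]
    by (simp add: U(2) matrix_vector_mult_diff_distrib)
  have "matrix_of_columns (\<lambda>i. f (w i + vertex_average P) - vertex_average P') = U ** matrix_of_columns w"
    by (simp add: lin vec_eq_iff matrix_of_columns_def matrix_matrix_mult_def matrix_vector_mult_def)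
  then have rec: "reconstructed_matrix P P' f w = U"
    using matrix_mult_matrix_inv[OF invertible_matrix_of_selection[OF w]]
    by (simp add: reconstructed_matrix_def matrix_mul_assoc[symmetric])
  have "(\<lambda>v. U *v v) ` centered_vertices P = centered_vertices P'"
    by (simp add: centered_vertices_def unimodular_transformation_vertices[OF f] image_image lin)
  then show "accepted P P' (reconstructed_matrix P P' f w)"
    by (simp add: rec accepted_def U(1))
  show "transformation_of P P' (reconstructed_matrix P P' f w) = f"
    unfolding rec transformation_of_def by (simp add: lin[symmetric])
qed

theorem theorem5p7:
  fixes P P' :: "(real ^ 'n) set" and d :: nat
  assumes "lattice_polytope P" and "lattice_polytope P'"
    and "aff_dim P = int CARD('n)" and "aff_dim P' = int CARD('n)"
    and "card (vertices P) = d" and "card (vertices P') = d"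
  shows "(\<exists>R. algorithm_run P P' R) \<and>
         (\<forall>R. algorithm_run P P' R \<longrightarrow> R = unimodular_transformations P P')"
proof (intro conjI allI impI)
  have poly: "polytope P" and ne: "P \<noteq> {}"
    using assms(1,3) lattice_polytope_vertices(1) by auto
  obtain T where T: "T \<in> minimum_spanning_trees P"
    using minimum_spanning_tree_exists[OF poly] by blast
  obtain w where w: "valid_selection P w"
    using valid_selection_exists[OF poly assms(3)] by blast
  show "\<exists>R. algorithm_run P P' R"
    unfolding algorithm_run_def using T w by (intro exI[of _ "\<lambda>_ _. w"] exI conjI) auto
next
  fix R assume "algorithm_run P P' R"
  then obtain T sel where T: "T \<in> minimum_spanning_trees P"
    and sel: "\<And>\<phi> \<sigma>. (\<phi>, \<sigma>) \<in> candidates P P' T \<Longrightarrow> valid_selection P (sel \<phi> \<sigma>)"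
    and R: "R = {transformation_of P P' U | U \<phi> \<sigma>. (\<phi>, \<sigma>) \<in> candidates P P' T \<and>
               U = reconstructed_matrix P P' (\<phi> \<circ> \<sigma>) (sel \<phi> \<sigma>) \<and> accepted P P' U}"
    unfolding algorithm_run_def by blast
  have poly: "polytope P" and ne: "P \<noteq> {}"
    using assms(1,3) lattice_polytope_vertices(1) by auto
  show "R = unimodular_transformations P P'"
  proof
    show "R \<subseteq> unimodular_transformations P P'"
      unfolding R using accepted_imp_unimodular_transformation[OF assms(1) ne assms(2)] by blast
    show "unimodular_transformations P P' \<subseteq> R"
    proof
      fix f assume f: "f \<in> unimodular_transformations P P'"
      have cand: "(f, id) \<in> candidates P P' T"
        by (rule unimodular_transformation_candidate[OF f T])
      then show "f \<in> R"
        using unimodular_transformation_recovered[OF f poly ne sel[OF cand]]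
        unfolding R by (intro CollectI exI[of _ f] exI[of _ id] exI[of _ "reconstructed_matrix P P' f (sel f id)"]) simp
    qed
  qed
qed

end
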